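(* Let $s\ge k_1\ge2$ and $\Gamma=\Gamma_{k_1,k_1,s}=\Gamma_{k_1,k_1}\cup\{12\cdots s(s+1)\}$. Then $U_{\Gamma,1}(y)=-y$ and for $n\ge2$ $$U_{\Gamma,n}(y)=-y\sum_{r=1}^{k_1-1}U_{\Gamma,n-r}(y)-y\sum_{p=0}^{s-k_1}\left[\left(1+\binom{n-p-2}{k_1-1}\right)U_{\Gamma,n-p-k_1}(y)+y\binom{n-p-2}{k_1-1}\sum_{a=1}^{k_1-1}U_{\Gamma,n-p-k_1-a}(y)\right].$$
   Context: $\Gamma_{k_1,k_2}=\{\sigma\in\mathfrak S_{k_1+k_2}:\sigma_1=1,\ \sigma_{k_1+1}=2,\ \sigma_1<\cdots<\sigma_{k_1},\ \sigma_{k_1+1}<\cdots<\sigma_{k_1+k_2}\}$, and $12\cdots s(s+1)$ is the identity of $\mathfrak S_{s+1}$. For $\sigma\in\mathfrak S_n$, $\mathrm{des}(\sigma)$ is the number of $i$ with $\sigma_i>\sigma_{i+1}$. For distinct integers $\alpha=\alpha_1\cdots\alpha_r$, $\mathrm{red}(\alpha)\in\mathfrak S_r$ replaces the $i$-th smallest entry by $i$. $\sigma$ has a $\Gamma$-match starting at position $i$ if there is $j\ge1$ with $\mathrm{red}(\sigma_i\cdots\sigma_{i+j})\in\Gamma$; $\mathcal{NM}_n(\Gamma)$ is the set of $\sigma\in\mathfrak S_n$ with no $\Gamma$-match. The polynomials $U_{\Gamma,n}(y)$ are defined by $\sum_{n\ge0}U_{\Gamma,n}(y)\frac{t^n}{n!}=\left(1+\sum_{n\ge1}\frac{t^n}{n!}\sum_{\sigma\in\mathcal{NM}_n(\Gamma)}y^{1+\mathrm{des}(\sigma)}\right)^{-1}$;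 in particular $U_{\Gamma,0}=1$, and $U_{\Gamma,j}=0$ for $j<0$. Binomial coefficients $\binom{a}{b}$ are $0$ when $a<b$. *)

theory Defs
  imports
    "HOL-Combinatorics.Multiset_Permutations"
    "HOL-Computational_Algebra.Formal_Power_Series"
    "HOL-Computational_Algebra.Polynomial"
begin

text \<open>
  Permutations are lists in one-line notation: the symmetric group on \<open>n\<close> letters is
  \<open>permutations_of_set {1..n}\<close>, and the entry \<open>\<sigma>\<^sub>i\<close> is \<open>\<sigma> ! (i - 1)\<close>.
\<close>

definition des :: "nat list \<Rightarrow> nat" where
  "des \<sigma> = card {i. Suc i < length \<sigma> \<and> \<sigma> ! i > \<sigma> ! Suc i}"

definition red :: "nat list \<Rightarrow> nat list" where
  "red \<alpha> = map (\<lambda>x. card {y \<in> set \<alpha>. y \<le> x}) \<alpha>"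

text \<open>Here \<open>i\<close> counts from 0, and the window consists of the \<open>j + 1\<close> entries from there on.\<close>

definition match_at :: "nat list set \<Rightarrow> nat list \<Rightarrow> nat \<Rightarrow> bool" where
  "match_at \<Gamma> \<sigma> i \<longleftrightarrow>
     (\<exists>j\<ge>1. i + j < length \<sigma> \<and> red (take (j + 1) (drop i \<sigma>)) \<in> \<Gamma>)"

definition NM :: "nat list set \<Rightarrow> nat \<Rightarrow> nat list set" where
  "NM \<Gamma> n = {\<sigma> \<in> permutations_of_set {1..n}. \<not> (\<exists>i. match_at \<Gamma> \<sigma> i)}"

definition Gamma2 :: "nat \<Rightarrow> nat \<Rightarrow> nat list set" where
  "Gamma2 k1 k2 = {\<sigma> \<in> permutations_of_set {1..k1 + k2}.
     \<sigma> ! 0 = 1 \<and> \<sigma> ! k1 = 2 \<and> sorted_wrt (<) (take k1 \<sigma>) \<and> sorted_wrt (<) (drop k1 \<sigma>)}"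

definition Gamma3 :: "nat \<Rightarrow> nat \<Rightarrow> nat \<Rightarrow> nat list set" where
  "Gamma3 k1 k2 s = Gamma2 k1 k2 \<union> {[1..<s + 2]}"

abbreviation yvar :: "rat poly" where
  "yvar \<equiv> monom 1 1"

definition NM_egf :: "nat list set \<Rightarrow> rat poly fps" where
  "NM_egf \<Gamma> = Abs_fps (\<lambda>n. if n = 0 then 1
     else smult (1 / fact n) (\<Sum>\<sigma>\<in>NM \<Gamma> n. yvar ^ (1 + des \<sigma>)))"

text \<open>
  The coefficient ring \<open>rat poly\<close> is not a field, so the generic \<open>inverse\<close> on power series is
  unavailable; \<open>fps_right_inverse F 1\<close> is the inverse of a series \<open>F\<close> with constant term 1.
\<close>

definition U :: "nat list set \<Rightarrow> int \<Rightarrow> rat poly" where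
  "U \<Gamma> j = (if j < 0 then 0
     else smult (fact (nat j)) (fps_nth (fps_right_inverse (NM_egf \<Gamma>) 1) (nat j)))"

lemma NM_egf_times_U_egf:
  "NM_egf \<Gamma> * Abs_fps (\<lambda>n. smult (1 / fact n) (U \<Gamma> (int n))) = 1"
proof -
  have "Abs_fps (\<lambda>n. smult (1 / fact n) (U \<Gamma> (int n))) = fps_right_inverse (NM_egf \<Gamma>) 1"
    by (rule fps_ext) (simp add: U_def)
  moreover have "fps_nth (NM_egf \<Gamma>) 0 * 1 = 1"
    by (simp add: NM_egf_def)
  ultimately show ?thesis
    using fps_right_inverse by metis
qed

end

theory Submission
  imports Defs "HOL-Library.Infinite_Set" "HOL-Library.Sublist"
begin

text \<open>
  For every \<open>\<Gamma>\<close> whose patterns have at most one descent, the polynomial \<open>U\<^sub>n\<close> is a signed count of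
  tilings: cut a permutation into increasing \<open>\<Gamma>\<close>-avoiding bricks, each of weight \<open>- y\<close>, such that
  the entries increase from one brick to the next or else the two bricks together contain a match.
  To see this, consider pairs of a \<open>\<Gamma>\<close>-avoiding word \<open>\<alpha>\<close> followed by such a tiling. Moving the last
  increasing run of \<open>\<alpha>\<close> to the front of the tiling, or the first brick to the end of \<open>\<alpha>\<close>, is a
  sign-reversing involution on these pairs; hence the exponential generating function of the tilings
  is the inverse of the one of the avoiders.

  For \<open>\<Gamma>\<^bsub>k\<^sub>1,k\<^sub>2,s\<^esub>\<close> the bricks are the increasing words of length at most \<open>s\<close>, and a brick may be
  followed by a brick \<open>C\<close> with first entry \<open>c\<close> iff it starts below \<open>c\<close> and either none of its
  entries exceeds \<open>c\<close>, or exactly \<open>k\<^sub>1 - 1\<close> do and \<open>C\<close> has length at least \<open>k\<^sub>2\<close>. As first entries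
  increase, \<open>c\<close> is the smallest entry outside the first brick, which therefore is \<open>1 2 \<dots> r\<close>, giving
  the term \<open>- y U\<^bsub>n-r\<^esub>\<close>, or \<open>1 2 \<dots> (p+1)\<close> followed by \<open>k\<^sub>1 - 1\<close> arbitrary entries above \<open>p + 2\<close>.
  Finally, if \<open>k\<^sub>2 \<le> k\<^sub>1\<close>, a first brick shorter than \<open>k\<^sub>2\<close> is of the form \<open>1 2 \<dots> r\<close>, so the tilings of
  size \<open>m\<close> whose first brick has length at least \<open>k\<^sub>2\<close> contribute
  \<open>U\<^sub>m + y (U\<^bsub>m-1\<^esub> + \<dots> + U\<^bsub>m-k\<^sub>2+1\<^esub>)\<close>.
\<close>

section \<open>Increasing words and their last runs\<close>

abbreviation incr :: "'a :: linorder list \<Rightarrow> bool" where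
  "incr \<equiv> sorted_wrt (<)"

lemma incr_hd_le: "incr xs \<Longrightarrow> x \<in> set xs \<Longrightarrow> hd xs \<le> x"
  by (cases xs) auto

lemma incr_le_last: "incr xs \<Longrightarrow> x \<in> set xs \<Longrightarrow> x \<le> last xs"
  by (induction xs) (auto dest: last_in_set intro: less_imp_le)

lemma incr_eq_filter_append_filter:
  "incr xs \<Longrightarrow> c \<notin> set xs \<Longrightarrow> xs = filter (\<lambda>x. x < c) xs @ filter (\<lambda>x. c < x) xs"
proof (induction xs)
  case (Cons x xs)
  then have "filter (\<lambda>y. y < c) xs = []" if "c < x"
    using that by (auto simp: filter_empty_conv)
  then show ?case
    using Cons by auto
qed simp

lemma incr_map_iff:
  assumes "strict_mono_on (set xs) h"
  shows "incr (map h xs) \<longleftrightarrow> incr xs"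
  using strict_mono_on_less[OF assms] unfolding sorted_wrt_map
  by (auto intro: sorted_wrt_mono_rel[rotated])

definition last_run :: "'a :: linorder list \<Rightarrow> 'a list \<Rightarrow> bool" where
  "last_run xs R \<longleftrightarrow> R \<noteq> [] \<and> incr R \<and> (xs = [] \<or> hd R < last xs)"

lemma exists_last_run:
  "xs \<noteq> [] \<Longrightarrow> distinct xs \<Longrightarrow> \<exists>ys R. xs = ys @ R \<and> last_run ys R"
proof (induction xs rule: list_nonempty_induct)
  case (single x)
  then show ?case
    by (intro exI[of _ "[]"] exI[of _ "[x]"]) (simp add: last_run_def)
next
  case (cons x xs)
  then obtain ys R where xs_eq: "xs = ys @ R" and last_run: "last_run ys R"
    by auto
  show ?case
  proof (cases "ys = [] \<and> x < hd R")
    case True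
    then have "incr (x # R)"
      using last_run incr_hd_le by (fastforce simp: last_run_def)
    then show ?thesis
      using True xs_eq by (intro exI[of _ "[]"] exI[of _ "x # R"]) (simp add: last_run_def)
  next
    case False
    then have "last_run (x # ys) R"
      using last_run cons.prems xs_eq by (cases R) (auto simp: last_run_def)
    then show ?thesis
      using xs_eq by (intro exI[of _ "x # ys"] exI[of _ R]) simp
  qed
qed

lemma last_run_unique:
  assumes "xs @ R = ys @ Q" and "last_run xs R" and "last_run ys Q"
  shows "xs = ys \<and> R = Q"
proof -
  have append_Nil: "v = []" if "incr (v @ P)" "last_run (zs @ v) P" for v P zs :: "'a list"
  proof (rule ccontr)
    assume "v \<noteq> []"
    then have "last v < hd P" "hd P < last v"
      using that by (auto simp: last_run_def sorted_wrt_append)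
    then show False
      by simp
  qed
  from assms(1) obtain v where "xs = ys @ v \<and> v @ R = Q \<or> xs @ v = ys \<and> R = v @ Q"
    by (auto simp: append_eq_append_conv2)
  then show ?thesis
    using assms(2,3) append_Nil[of v R ys] append_Nil[of v Q xs] by (auto simp: last_run_def)
qed

section \<open>Descents and reduction\<close>

lemma des_Nil [simp]: "des [] = 0"
  by (simp add: des_def)

lemma des_Cons: "des (x # ys) = (if ys \<noteq> [] \<and> x > hd ys then 1 else 0) + des ys"
proof -
  let ?D = "\<lambda>zs. {i. Suc i < length zs \<and> zs ! i > zs ! Suc i}"
  have finite_D: "finite (?D ys)"
    by (rule finite_subset[of _ "{..<length ys}"]) auto
  have "?D (x # ys) = (if ys \<noteq> [] \<and> x > hd ys then {0} else {}) \<union> Suc ` ?D ys"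
    (is "_ = ?E \<union> _")
  proof (intro set_eqI)
    fix i
    show "i \<in> ?D (x # ys) \<longleftrightarrow> i \<in> ?E \<union> Suc ` ?D ys"
      by (cases i) (auto simp: hd_conv_nth)
  qed
  moreover have "card (?E \<union> Suc ` ?D ys) = card ?E + card (Suc ` ?D ys)"
    by (intro card_Un_disjoint) (auto simp: finite_D)
  ultimately show ?thesis
    by (simp add: des_def card_image)
qed

lemma des_append:
  "des (xs @ ys) =
     des xs + des ys + (if xs \<noteq> [] \<and> ys \<noteq> [] \<and> hd ys < last xs then 1 else 0)"
  by (induction xs) (auto simp: des_Cons)

lemma des_incr: "incr xs \<Longrightarrow> des xs = 0"
  by (induction xs) (auto simp: des_Cons dest!: hd_in_set)

lemma des_map:
  assumes "strict_mono_on (set xs) h"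
  shows "des (map h xs) = des xs"
proof -
  have "h (xs ! i) > h (xs ! Suc i) \<longleftrightarrow> xs ! i > xs ! Suc i" if "Suc i < length xs" for i
    using that by (intro strict_mono_on_less[OF assms]) auto
  then show ?thesis
    unfolding des_def by (intro arg_cong[where f = card]) auto
qed

definition rank :: "nat set \<Rightarrow> nat \<Rightarrow> nat" where
  "rank A x = card {y \<in> A. y \<le> x}"

lemma red_eq_map_rank: "red w = map (rank (set w)) w"
  by (simp add: red_def rank_def)

lemma strict_mono_on_rank:
  assumes "finite A"
  shows "strict_mono_on A (rank A)"
proof (rule strict_mono_onI)
  fix x y assume "x \<in> A" "y \<in> A" "x < y"
  then have "{z \<in> A. z \<le> x} \<subset> {z \<in> A. z \<le> y}"
    by (auto simp: psubset_eq set_eq_iff intro: exI[of _ y])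
  then show "rank A x < rank A y"
    unfolding rank_def using assms by (intro psubset_card_mono) auto
qed

lemma rank_image:
  assumes "finite A"
  shows "rank A ` A = {1..card A}"
proof (rule card_subset_eq)
  show "rank A ` A \<subseteq> {1..card A}"
    using assms by (auto simp: rank_def Suc_le_eq card_gt_0_iff intro: card_mono)
  show "card (rank A ` A) = card {1..card A}"
    using strict_mono_on_rank[OF assms] by (simp add: card_image strict_mono_on_imp_inj_on)
qed simp

lemma rank_image_strict_mono:
  assumes mono: "strict_mono_on A h" and "x \<in> A"
  shows "rank (h ` A) (h x) = rank A x"
proof -
  have "{y \<in> h ` A. y \<le> h x} = h ` {y \<in> A. y \<le> x}"
    using strict_mono_on_less_eq[OF mono] \<open>x \<in> A\<close> by auto
  moreover have "inj_on h {y \<in> A. y \<le> x}"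
    using strict_mono_on_imp_inj_on[OF mono] by (rule inj_on_subset) auto
  ultimately show ?thesis
    by (simp add: rank_def card_image)
qed

lemma red_map: "strict_mono_on (set w) h \<Longrightarrow> red (map h w) = red w"
  by (simp add: red_eq_map_rank rank_image_strict_mono)

lemma des_red: "des (red w) = des w"
  by (simp add: red_eq_map_rank des_map strict_mono_on_rank)

lemma red_in_permutations_of_set_iff:
  assumes "distinct w"
  shows "red w \<in> permutations_of_set {1..m} \<longleftrightarrow> length w = m"
proof -
  have "inj_on (rank (set w)) (set w)"
    by (intro strict_mono_on_imp_inj_on strict_mono_on_rank) simp
  then show ?thesis
    using assms rank_image[of "set w"]
    by (auto simp: red_eq_map_rank permutations_of_set_def distinct_map distinct_card)
qed

section \<open>Relabelling and sums over subsets\<close>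

lemma bij_betw_of_mem_iff:
  assumes "inj_on f L" "A \<subseteq> L" "B \<subseteq> f ` L" "\<And>x. x \<in> L \<Longrightarrow> f x \<in> B \<longleftrightarrow> x \<in> A"
  shows "bij_betw f A B"
  unfolding bij_betw_def using assms by (blast intro: inj_on_subset)

lemma sum_eq_of_relabelling:
  fixes \<A> :: "nat set \<Rightarrow> 'b set" and relabel :: "(nat \<Rightarrow> nat) \<Rightarrow> 'b \<Rightarrow> 'b"
    and f :: "'b \<Rightarrow> 'c :: comm_monoid_add"
  assumes bij: "\<And>S h. strict_mono_on S h \<Longrightarrow> bij_betw (relabel h) (\<A> S) (\<A> (h ` S))"
    and f_relabel: "\<And>S h x. strict_mono_on S h \<Longrightarrow> x \<in> \<A> S \<Longrightarrow> f (relabel h x) = f x"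
    and "finite S" "finite T" "card S = card T"
  shows "sum f (\<A> S) = sum f (\<A> T)"
proof -
  have "sum f (\<A> V) = sum f (\<A> {..<card V})" if finite_V: "finite V" for V :: "nat set"
  proof -
    obtain h where order_iso: "bij_betw h {..<card V} V" "strict_mono_on {..<card V} h"
      using ex_bij_betw_strict_mono_card[OF finite_V] .
    have "sum f (\<A> {..<card V}) = (\<Sum>x\<in>\<A> {..<card V}. f (relabel h x))"
      using f_relabel[OF order_iso(2)] by simp
    also have "\<dots> = sum f (\<A> V)"
      using sum.reindex_bij_betw[OF bij[OF order_iso(2)], of f] order_iso(1)
      by (simp add: bij_betw_def)
    finally show ?thesis ..
  qed
  from this[of S] this[of T] show ?thesis
    using assms(3-5) by simp
qed

lemma sum_Pow_card:
  fixes F :: "nat \<Rightarrow> 'a :: comm_semiring_1"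
  assumes "finite S"
  shows "(\<Sum>T\<in>Pow S. F (card T)) = (\<Sum>i\<le>card S. of_nat (card S choose i) * F i)"
proof -
  have "(\<Sum>T\<in>Pow S. F (card T)) = (\<Sum>i\<le>card S. \<Sum>T\<in>{T \<in> Pow S. card T = i}. F (card T))"
    using assms by (intro sum.group[symmetric]) (auto intro: card_mono)
  also have "\<dots> = (\<Sum>i\<le>card S. of_nat (card S choose i) * F i)"
    using assms by (intro sum.cong) (simp_all add: n_subsets)
  finally show ?thesis .
qed

lemma initial_segment_Un_eq_iff:
  fixes n :: nat
  assumes "Y \<subseteq> {r + 2..n}" "Y' \<subseteq> {r' + 2..n}"
  shows "{1..r} \<union> Y = {1..r'} \<union> Y' \<longleftrightarrow> r = r' \<and> Y = Y'"
proof
  assume eq: "{1..r} \<union> Y = {1..r'} \<union> Y'"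
  have "r + 1 \<notin> {1..r} \<union> Y" "r' + 1 \<notin> {1..r'} \<union> Y'"
    using assms by auto
  then have "r + 1 \<notin> {1..r'}" "r' + 1 \<notin> {1..r}"
    using eq by blast+
  then have "r = r'"
    by simp
  moreover have "Y = ({1..r} \<union> Y) - {1..r}" "Y' = ({1..r'} \<union> Y') - {1..r'}"
    using assms by auto
  ultimately show "r = r' \<and> Y = Y'"
    using eq by metis
qed auto

lemma obtain_initial_segment:
  fixes n :: nat
  assumes "T \<subseteq> {1..n}" "1 \<in> T"
  obtains r where "r \<in> {1..n}" "{1..r} \<subseteq> T" "T - {1..r} \<subseteq> {r + 2..n}"
proof -
  have "n + 1 \<notin> insert 0 T" "\<not> 0 \<notin> insert 0 T"
    using assms(1) by auto
  then obtain r where initial: "\<forall>x\<le>r. x \<in> insert 0 T" and gap: "r + 1 \<notin> insert 0 T"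
    using ex_least_nat_less[of "\<lambda>x. x \<notin> insert 0 T" "n + 1"] by auto
  have "r \<noteq> 0"
    using gap assms(2) by (cases r) auto
  then have "r \<in> T" "{1..r} \<subseteq> T"
    using initial by auto
  moreover have "r + 2 \<le> x" if "x \<in> T" "x \<notin> {1..r}" for x
  proof -
    have "x \<noteq> r + 1" "1 \<le> x"
      using that(1) gap assms(1) by auto
    then show ?thesis
      using that(2) by simp
  qed
  then have "T - {1..r} \<subseteq> {r + 2..n}"
    using assms(1) by auto
  ultimately show thesis
    using that assms(1) by blast
qed

lemma bij_betw_initial_segment_Un:
  fixes n :: nat
  shows "bij_betw (\<lambda>(r, Y). {1..r} \<union> Y) (SIGMA r:{1..n}. Pow {r + 2..n}) {T. T \<subseteq> {1..n} \<and> 1 \<in> T}"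
    (is "bij_betw ?f ?S _")
proof (rule bij_betw_imageI)
  show "inj_on ?f ?S"
    by (rule inj_onI) (auto simp: initial_segment_Un_eq_iff simp del: One_nat_def)
  show "?f ` ?S = {T. T \<subseteq> {1..n} \<and> 1 \<in> T}"
  proof (intro equalityI subsetI)
    fix T assume "T \<in> {T. T \<subseteq> {1..n} \<and> 1 \<in> T}"
    then obtain r where "r \<in> {1..n}" "{1..r} \<subseteq> T" "T - {1..r} \<subseteq> {r + 2..n}"
      using obtain_initial_segment[of T n] by blast
    then have "(r, T - {1..r}) \<in> ?S" "T = ?f (r, T - {1..r})"
      by auto
    then show "T \<in> ?f ` ?S"
      by (rule rev_image_eqI)
  qed auto
qed

lemma sum_subsets_containing_1:
  fixes n :: nat
  shows "(\<Sum>T | T \<subseteq> {1..n} \<and> 1 \<in> T. f T) = (\<Sum>r = 1..n. \<Sum>Y\<in>Pow {r + 2..n}. f ({1..r} \<union> Y))"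
  using sum.reindex_bij_betw[OF bij_betw_initial_segment_Un, of f n]
  by (simp add: sum.Sigma case_prod_unfold)

section \<open>Exponential generating functions\<close>

definition egf :: "(nat \<Rightarrow> 'a :: field_char_0 poly) \<Rightarrow> 'a poly fps" where
  "egf a = Abs_fps (\<lambda>n. smult (1 / fact n) (a n))"

lemma inj_egf: "inj egf"
proof (rule injI, rule ext)
  fix a b :: "nat \<Rightarrow> 'a poly" and n
  assume "egf a = egf b"
  then have "fps_nth (egf a) n = fps_nth (egf b) n"
    by simp
  then show "a n = b n"
    by (simp add: egf_def smult_eq_iff)
qed

lemma smult_sum_right: "smult c (\<Sum>i\<in>I. f i) = (\<Sum>i\<in>I. smult c (f i))"
  by (induction I rule: infinite_finite_induct) (simp_all add: smult_add_right)

lemma egf_mult: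
  "egf a * egf b = egf (\<lambda>n. \<Sum>i\<le>n. of_nat (n choose i) * (a i * b (n - i)))"
proof (rule fps_ext)
  fix n
  have "fps_nth (egf a * egf b) n =
      (\<Sum>i\<le>n. smult (1 / (fact i * fact (n - i))) (a i * b (n - i)))"
    by (simp add: egf_def fps_mult_nth atLeast0AtMost mult.commute)
  also have "\<dots> = (\<Sum>i\<le>n. smult (1 / fact n) (of_nat (n choose i) * (a i * b (n - i))))"
    by (intro sum.cong) (simp_all add: binomial_fact of_nat_poly)
  finally show "fps_nth (egf a * egf b) n =
      fps_nth (egf (\<lambda>n. \<Sum>i\<le>n. of_nat (n choose i) * (a i * b (n - i)))) n"
    by (simp add: egf_def smult_sum_right)
qed

section \<open>Avoiders and brick tilings\<close>

locale pattern_set =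
  fixes \<Gamma> :: "nat list set"
begin

definition matches :: "nat list \<Rightarrow> bool" where
  "matches w \<longleftrightarrow> 2 \<le> length w \<and> red w \<in> \<Gamma>"

definition avoids :: "nat list \<Rightarrow> bool" where
  "avoids xs \<longleftrightarrow> (\<forall>w. sublist w xs \<longrightarrow> \<not> matches w)"

lemma avoids_sublist: "avoids ys \<Longrightarrow> sublist xs ys \<Longrightarrow> avoids xs"
  unfolding avoids_def by (metis sublist_order.order_trans)

lemma avoids_Nil [simp]: "avoids []"
  by (simp add: avoids_def matches_def)

lemma avoids_map_iff:
  assumes "strict_mono_on (set xs) h"
  shows "avoids (map h xs) \<longleftrightarrow> avoids xs"
proof -
  have "matches (map h w) \<longleftrightarrow> matches w" if "sublist w xs" for w
    using red_map[OF monotone_on_subset[OF assms set_mono_sublist[OF that]]]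
    by (simp add: matches_def)
  then show ?thesis
    unfolding avoids_def by (metis map_mono_sublist sublist_map_rightE)
qed

lemma match_at_iff_not_avoids: "(\<exists>i. match_at \<Gamma> \<sigma> i) \<longleftrightarrow> \<not> avoids \<sigma>"
proof
  assume "\<exists>i. match_at \<Gamma> \<sigma> i"
  then obtain i j where "1 \<le> j" "i + j < length \<sigma>" "red (take (j + 1) (drop i \<sigma>)) \<in> \<Gamma>"
    unfolding match_at_def by blast
  then have "matches (take (j + 1) (drop i \<sigma>))"
    by (simp add: matches_def)
  moreover have "sublist (take (j + 1) (drop i \<sigma>)) \<sigma>"
    using sublist_take sublist_drop sublist_order.order_trans by blast
  ultimately show "\<not> avoids \<sigma>"
    unfolding avoids_def by blast
next
  assume "\<not> avoids \<sigma>"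
  then obtain u w v where \<sigma>_eq: "\<sigma> = u @ w @ v" and "matches w"
    unfolding avoids_def sublist_def by blast
  then show "\<exists>i. match_at \<Gamma> \<sigma> i"
    unfolding match_at_def matches_def \<sigma>_eq
    by (intro exI[of _ "length u"] exI[of _ "length w - 1"]) auto
qed

definition avoiders :: "nat set \<Rightarrow> nat list set" where
  "avoiders S = {\<sigma> \<in> permutations_of_set S. avoids \<sigma>}"

lemma NM_eq_avoiders: "NM \<Gamma> n = avoiders {1..n}"
  by (simp add: NM_def avoiders_def match_at_iff_not_avoids)

definition brick :: "nat list \<Rightarrow> bool" where
  "brick B \<longleftrightarrow> B \<noteq> [] \<and> incr B \<and> avoids B"

definition linked :: "nat list \<Rightarrow> nat list \<Rightarrow> bool" where
  "linked B C \<longleftrightarrow> last B < hd C \<or> \<not> avoids (B @ C)"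

definition admissible :: "nat list list \<Rightarrow> bool" where
  "admissible Bs \<longleftrightarrow> (\<forall>B\<in>set Bs. brick B) \<and> successively linked Bs"

definition tilings :: "nat set \<Rightarrow> nat list list set" where
  "tilings S = {Bs. admissible Bs \<and> distinct (concat Bs) \<and> set (concat Bs) = S}"

lemma admissible_Nil [simp]: "admissible []"
  by (simp add: admissible_def)

lemma admissible_Cons:
  "admissible (B # Bs) \<longleftrightarrow> brick B \<and> (Bs = [] \<or> linked B (hd Bs)) \<and> admissible Bs"
  by (auto simp: admissible_def successively_Cons)

lemma tilings_empty [simp]: "tilings {} = {[]}"
  by (auto simp: tilings_def admissible_def brick_def dest: hd_in_set)

lemma Nil_in_tilings_iff [simp]: "[] \<in> tilings S \<longleftrightarrow> S = {}"
  by (auto simp: tilings_def)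

lemma finite_avoiders [simp]: "finite S \<Longrightarrow> finite (avoiders S)"
  by (simp add: avoiders_def)

lemma finite_tilings [simp]:
  assumes "finite S"
  shows "finite (tilings S)"
proof (rule finite_subset)
  let ?L = "{B. set B \<subseteq> S \<and> length B \<le> card S}"
  have length_le: "length Bs \<le> length (concat Bs)" if "\<forall>B\<in>set Bs. B \<noteq> []"
    for Bs :: "nat list list"
    using that by (induction Bs) (auto simp: neq_Nil_conv)
  show "tilings S \<subseteq> {Bs. set Bs \<subseteq> ?L \<and> length Bs \<le> card S}"
  proof
    fix Bs assume tiling: "Bs \<in> tilings S"
    then have length_concat: "length (concat Bs) = card S"
      using distinct_card[of "concat Bs"] by (simp add: tilings_def)
    have "length B \<le> card S" if "B \<in> set Bs" for B
      using split_list[OF that] by (auto simp flip: length_concat)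
    moreover have "set B \<subseteq> S" if "B \<in> set Bs" for B
      using that tiling by (auto simp: tilings_def)
    ultimately show "Bs \<in> {Bs. set Bs \<subseteq> ?L \<and> length Bs \<le> card S}"
      using tiling length_le[of Bs] length_concat
      by (auto simp: tilings_def admissible_def brick_def)
  qed
  show "finite {Bs. set Bs \<subseteq> ?L \<and> length Bs \<le> card S}"
    using assms by (intro finite_lists_length_le)
qed

lemma linked_map_iff:
  assumes mono: "strict_mono_on (set B \<union> set C) h" and "B \<noteq> []" "C \<noteq> []"
  shows "linked (map h B) (map h C) \<longleftrightarrow> linked B C"
proof -
  have "h (last B) < h (hd C) \<longleftrightarrow> last B < hd C"
    using assms by (intro strict_mono_on_less[OF mono]) auto
  moreover have "avoids (map h B @ map h C) \<longleftrightarrow> avoids (B @ C)"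
    using mono avoids_map_iff[of "B @ C" h] by simp
  ultimately show ?thesis
    using assms(2,3) by (simp add: linked_def last_map hd_map)
qed

lemma admissible_map_iff:
  assumes "strict_mono_on (set (concat Bs)) h"
  shows "admissible (map (map h) Bs) \<longleftrightarrow> admissible Bs"
  using assms
proof (induction Bs)
  case (Cons B Bs)
  have mono: "strict_mono_on A h" if "A \<subseteq> set (concat (B # Bs))" for A
    using Cons.prems that by (rule monotone_on_subset)
  have brick: "brick (map h B) \<longleftrightarrow> brick B"
    using mono[of "set B"] incr_map_iff[of B h] avoids_map_iff[of B h] by (auto simp: brick_def)
  have linked: "linked (map h B) (map h (hd Bs)) \<longleftrightarrow> linked B (hd Bs)"
    if "brick B" "brick (hd Bs)" "Bs \<noteq> []"
    using that hd_in_set[OF that(3)] by (intro linked_map_iff mono) (auto simp: brick_def)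
  have "admissible (map (map h) Bs) \<longleftrightarrow> admissible Bs"
    by (intro Cons.IH mono) auto
  then show ?case
    using brick linked by (cases Bs) (auto simp: admissible_Cons)
qed simp

lemma bij_betw_map_avoiders:
  assumes mono: "strict_mono_on S h"
  shows "bij_betw (map h) (avoiders S) (avoiders (h ` S))"
proof (rule bij_betw_of_mem_iff)
  note inj = strict_mono_on_imp_inj_on[OF mono]
  show "inj_on (map h) (lists S)"
    using inj by (simp add: inj_on_map_lists)
  show "avoiders S \<subseteq> lists S" "avoiders (h ` S) \<subseteq> map h ` lists S"
    by (auto simp: avoiders_def permutations_of_set_def simp flip: lists_image)
  fix \<sigma> assume "\<sigma> \<in> lists S"
  then have \<sigma>_subset: "set \<sigma> \<subseteq> S"
    by auto
  then show "map h \<sigma> \<in> avoiders (h ` S) \<longleftrightarrow> \<sigma> \<in> avoiders S"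
    using avoids_map_iff[OF monotone_on_subset[OF mono \<sigma>_subset]] inj_on_subset[OF inj \<sigma>_subset]
      inj_on_image_eq_iff[OF inj \<sigma>_subset order_refl]
    by (simp add: avoiders_def permutations_of_set_def distinct_map)
qed

lemma bij_betw_map_tilings:
  assumes mono: "strict_mono_on S h"
  shows "bij_betw (map (map h)) (tilings S) (tilings (h ` S))"
proof (rule bij_betw_of_mem_iff)
  note inj = strict_mono_on_imp_inj_on[OF mono]
  show "inj_on (map (map h)) (lists (lists S))"
    using inj by (simp add: inj_on_map_lists)
  show "tilings S \<subseteq> lists (lists S)" "tilings (h ` S) \<subseteq> map (map h) ` lists (lists S)"
    by (auto simp: tilings_def simp flip: lists_image)
  fix Bs assume "Bs \<in> lists (lists S)"
  then have Bs_subset: "set (concat Bs) \<subseteq> S"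
    by auto
  have "concat (map (map h) Bs) = map h (concat Bs)"
    by (rule map_concat[symmetric])
  then show "map (map h) Bs \<in> tilings (h ` S) \<longleftrightarrow> Bs \<in> tilings S"
    using admissible_map_iff[OF monotone_on_subset[OF mono Bs_subset]]
      inj_on_subset[OF inj Bs_subset] inj_on_image_eq_iff[OF inj Bs_subset order_refl]
    by (simp add: tilings_def distinct_map del: set_concat)
qed

definition avoider_weight :: "nat list \<Rightarrow> rat poly" where
  "avoider_weight \<alpha> = (if \<alpha> = [] then 1 else yvar ^ (1 + des \<alpha>))"

definition tiling_weight :: "nat list list \<Rightarrow> rat poly" where
  "tiling_weight Bs = (- yvar) ^ length Bs"

definition avoider_sum :: "nat \<Rightarrow> rat poly" where
  "avoider_sum n = sum avoider_weight (avoiders {1..n})"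

definition tiling_sum :: "nat \<Rightarrow> rat poly" where
  "tiling_sum n = sum tiling_weight (tilings {1..n})"

lemma sum_avoider_weight:
  assumes "finite S"
  shows "sum avoider_weight (avoiders S) = avoider_sum (card S)"
  unfolding avoider_sum_def
proof (rule sum_eq_of_relabelling[OF bij_betw_map_avoiders])
  fix T and h :: "nat \<Rightarrow> nat" and \<sigma>
  assume "strict_mono_on T h" "\<sigma> \<in> avoiders T"
  then show "avoider_weight (map h \<sigma>) = avoider_weight \<sigma>"
    by (simp add: avoider_weight_def avoiders_def permutations_of_set_def des_map)
qed (use assms in auto)

lemma sum_tiling_weight:
  assumes "finite S"
  shows "sum tiling_weight (tilings S) = tiling_sum (card S)"
  unfolding tiling_sum_def
  by (rule sum_eq_of_relabelling[OF bij_betw_map_tilings])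
    (use assms in \<open>auto simp: tiling_weight_def\<close>)

lemma avoider_sum_0: "avoider_sum 0 = 1"
proof -
  have "avoiders {} = {[]}"
    by (auto simp: avoiders_def)
  then show ?thesis
    by (simp add: avoider_sum_def avoider_weight_def)
qed

lemma tiling_sum_0: "tiling_sum 0 = 1"
  by (simp add: tiling_sum_def tiling_weight_def)

lemma NM_egf_eq: "NM_egf \<Gamma> = egf avoider_sum"
proof (rule fps_ext)
  fix n
  have "avoider_sum n = (\<Sum>\<sigma>\<in>NM \<Gamma> n. yvar ^ (1 + des \<sigma>))" if "n \<noteq> 0"
    unfolding avoider_sum_def NM_eq_avoiders
    using that
    by (intro sum.cong) (auto simp: avoider_weight_def avoiders_def permutations_of_set_def)
  then show "fps_nth (NM_egf \<Gamma>) n = fps_nth (egf avoider_sum) n"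
    by (simp add: NM_egf_def egf_def avoider_sum_0)
qed

end

section \<open>The sign-reversing involution\<close>

locale single_descent_patterns = pattern_set +
  assumes des_le_1: "\<gamma> \<in> \<Gamma> \<Longrightarrow> des \<gamma> \<le> 1"
begin

text \<open>A match created by appending \<open>C\<close> has its only descent right before \<open>C\<close>, so it cannot
  extend to the left beyond the last run.\<close>

lemma not_avoids_last_run_append:
  assumes "avoids (xs @ R)" "avoids C" "last_run xs R" "hd C < last R"
    and "\<not> avoids (xs @ R @ C)"
  shows "\<not> avoids (R @ C)"
proof
  assume "avoids (R @ C)"
  obtain w where "sublist w ((xs @ R) @ C)" and match_w: "matches w"
    using assms(5) by (auto simp: avoids_def)
  then obtain t x where w_split: "w = t @ x" "suffix t (xs @ R)" "prefix x C"
    using assms(1,2) unfolding sublist_append[of w "xs @ R"] avoids_def by blast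
  have no_match: "\<not> sublist w (R @ C)" "\<not> sublist w (xs @ R)"
    using \<open>avoids (R @ C)\<close> assms(1) match_w by (auto simp: avoids_def)
  have "\<not> suffix t R"
    using no_match(1) w_split(1,3) unfolding sublist_append[of w R C] by fast
  moreover have "x \<noteq> []"
  proof
    assume "x = []"
    then show False
      using no_match(2) w_split(1) suffix_imp_sublist[OF w_split(2)] by simp
  qed
  ultimately obtain p where t_eq: "t = p @ R" "suffix p xs" "p \<noteq> []"
    using w_split(2) unfolding suffix_append by (metis append_Nil suffix_order.order_refl)
  have "last p = last xs" "xs \<noteq> []" "hd x = hd C"
    using t_eq w_split(3) \<open>x \<noteq> []\<close> by (auto simp: suffix_def prefix_def)
  then have "2 \<le> des w"
    using assms(3,4) \<open>x \<noteq> []\<close> t_eq by (simp add: w_split des_append last_run_def)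
  then show False
    using des_le_1[of "red w"] match_w by (simp add: des_red matches_def)
qed

definition configs :: "nat set \<Rightarrow> (nat list \<times> nat list list) set" where
  "configs S = {(\<alpha>, Bs). avoids \<alpha> \<and> admissible Bs \<and> distinct (\<alpha> @ concat Bs) \<and>
     set \<alpha> \<union> set (concat Bs) = S}"

lemma configs_eq_UN: "configs S = (\<Union>T\<in>Pow S. avoiders T \<times> tilings (S - T))"
  by (auto simp: configs_def avoiders_def tilings_def permutations_of_set_def)

lemma finite_configs [simp]: "finite S \<Longrightarrow> finite (configs S)"
  unfolding configs_eq_UN by (auto dest: finite_subset)

definition config_weight :: "nat list \<times> nat list list \<Rightarrow> rat poly" where
  "config_weight = (\<lambda>(\<alpha>, Bs). avoider_weight \<alpha> * tiling_weight Bs)"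

definition movable :: "nat list \<times> nat list list \<Rightarrow> bool" where
  "movable = (\<lambda>(\<alpha>, Bs). Bs \<noteq> [] \<and> last_run \<alpha> (hd Bs) \<and> avoids (\<alpha> @ hd Bs))"

definition move :: "nat list \<times> nat list list \<Rightarrow> nat list \<times> nat list list" where
  "move = (\<lambda>(\<alpha>, Bs). (\<alpha> @ hd Bs, tl Bs))"

lemma movable_Cons [simp]:
  "movable (\<alpha>, B # Bs) \<longleftrightarrow> last_run \<alpha> B \<and> avoids (\<alpha> @ B)"
  by (simp add: movable_def)

lemma move_Cons [simp]: "move (\<alpha>, B # Bs) = (\<alpha> @ B, Bs)"
  by (simp add: move_def)

lemma movableE:
  assumes "movable c"
  obtains \<alpha> B Bs where "c = (\<alpha>, B # Bs)" "last_run \<alpha> B" "avoids (\<alpha> @ B)"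
  using assms by (cases c) (auto simp: movable_def neq_Nil_conv)

lemma inj_on_move: "inj_on move {c. movable c}"
proof (rule inj_onI)
  fix c d assume "c \<in> {c. movable c}" "d \<in> {c. movable c}" and move: "move c = move d"
  then obtain \<alpha> B Bs \<beta> C Cs where "c = (\<alpha>, B # Bs)" "last_run \<alpha> B" "d = (\<beta>, C # Cs)" "last_run \<beta> C"
    by (auto elim!: movableE)
  then show "c = d"
    using move last_run_unique[of \<alpha> B \<beta> C] by simp
qed

lemma move_in_configs_not_movable:
  assumes "c \<in> configs S" "movable c"
  shows "move c \<in> configs S" "\<not> movable (move c)"
proof -
  obtain \<alpha> B Bs where c_eq: "c = (\<alpha>, B # Bs)" and run_B: "last_run \<alpha> B" "avoids (\<alpha> @ B)"
    using assms(2) by (rule movableE)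
  show "move c \<in> configs S"
    using assms(1) run_B by (auto simp: c_eq configs_def admissible_Cons)
  show "\<not> movable (move c)"
  proof
    assume "movable (move c)"
    then obtain \<alpha>' C Cs where "move c = (\<alpha>', C # Cs)" "last_run \<alpha>' C" "avoids (\<alpha>' @ C)"
      by (rule movableE)
    then have Bs_eq: "Bs = C # Cs" and run_C: "last_run (\<alpha> @ B) C" "avoids ((\<alpha> @ B) @ C)"
      by (simp_all add: c_eq)
    have "hd C < last B"
      using run_B(1) run_C(1) by (simp add: last_run_def)
    moreover have "avoids (B @ C)"
      using run_C(2) by (rule avoids_sublist) simp
    ultimately show False
      using assms(1) by (auto simp: c_eq Bs_eq configs_def admissible_Cons linked_def)
  qed
qed

lemma linked_last_run_of_not_movable:
  assumes "(xs @ R, C # Cs) \<in> configs S" "last_run xs R" "\<not> movable (xs @ R, C # Cs)"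
  shows "linked R C"
proof (rule ccontr)
  assume "\<not> linked R C"
  then have "\<not> last R < hd C" "avoids (R @ C)"
    by (auto simp: linked_def)
  have brick_C: "brick C" "set R \<inter> set C = {}" and avoids: "avoids (xs @ R)"
    using assms(1) by (auto simp: configs_def admissible_Cons)
  have "hd C \<in> set C" "last R \<in> set R"
    using brick_C(1) assms(2) by (simp_all add: brick_def last_run_def)
  then have "last R \<noteq> hd C"
    using brick_C(2) by auto
  then have descent: "hd C < last R"
    using \<open>\<not> last R < hd C\<close> by simp
  then have "last_run (xs @ R) C"
    using brick_C(1) assms(2) by (simp add: last_run_def brick_def)
  then have "\<not> avoids (xs @ R @ C)"
    using assms(3) by simp
  then have "\<not> avoids (R @ C)"
    using not_avoids_last_run_append[OF avoids _ assms(2) descent] brick_C(1)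
    by (simp add: brick_def)
  then show False
    using \<open>avoids (R @ C)\<close> by simp
qed

lemma move_surj:
  assumes "c \<in> configs S" "\<not> movable c" "S \<noteq> {}"
  obtains b where "b \<in> configs S" "movable b" "move b = c"
proof -
  obtain \<beta> Cs where c_eq: "c = (\<beta>, Cs)"
    by (cases c)
  have avoids_\<beta>: "avoids \<beta>" "distinct \<beta>"
    using assms(1) by (auto simp: c_eq configs_def)
  have "\<beta> \<noteq> []"
    using assms by (cases Cs) (auto simp: c_eq configs_def admissible_Cons brick_def last_run_def)
  then obtain xs R where \<beta>_split: "\<beta> = xs @ R" "last_run xs R"
    using exists_last_run[OF _ avoids_\<beta>(2)] by blast
  have "brick R"
    using \<beta>_split avoids_\<beta>(1) avoids_sublist[of "xs @ R" R] by (simp add: brick_def last_run_def)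
  moreover have "Cs = [] \<or> linked R (hd Cs)"
    using assms(1,2) \<beta>_split linked_last_run_of_not_movable by (cases Cs) (auto simp: c_eq)
  ultimately have "(xs, R # Cs) \<in> configs S"
    using assms(1) \<beta>_split avoids_sublist[of "xs @ R" xs]
    by (auto simp: c_eq configs_def admissible_Cons)
  moreover have "movable (xs, R # Cs)" "move (xs, R # Cs) = c"
    using \<beta>_split avoids_\<beta>(1) by (auto simp: c_eq)
  ultimately show thesis
    using that by blast
qed

lemma bij_betw_move:
  assumes "S \<noteq> {}"
  shows "bij_betw move {c \<in> configs S. movable c} {c \<in> configs S. \<not> movable c}"
  unfolding bij_betw_def
proof
  show "inj_on move {c \<in> configs S. movable c}"
    using inj_on_move by (rule inj_on_subset) auto
  show "move ` {c \<in> configs S. movable c} = {c \<in> configs S. \<not> movable c}"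
  proof (intro equalityI subsetI)
    fix c assume "c \<in> {c \<in> configs S. \<not> movable c}"
    then obtain b where "b \<in> configs S" "movable b" "move b = c"
      using move_surj[OF _ _ assms] by blast
    then show "c \<in> move ` {c \<in> configs S. movable c}"
      by blast
  qed (use move_in_configs_not_movable in auto)
qed

lemma config_weight_move:
  assumes "movable c"
  shows "config_weight (move c) = - config_weight c"
proof -
  obtain \<alpha> B Bs where c_eq: "c = (\<alpha>, B # Bs)" and run_B: "last_run \<alpha> B"
    using assms by (rule movableE)
  have "avoider_weight (\<alpha> @ B) = avoider_weight \<alpha> * yvar"
    using run_B by (auto simp: avoider_weight_def des_append des_incr last_run_def)
  then show ?thesis
    by (simp add: c_eq config_weight_def tiling_weight_def)
qed

lemma sum_config_weight_eq_0:
  assumes "finite S" "S \<noteq> {}"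
  shows "sum config_weight (configs S) = 0"
proof -
  let ?M = "{c \<in> configs S. movable c}" and ?N = "{c \<in> configs S. \<not> movable c}"
  have "sum config_weight ?N = (\<Sum>c\<in>?M. config_weight (move c))"
    using sum.reindex_bij_betw[OF bij_betw_move[OF assms(2)], of config_weight] by simp
  also have "\<dots> = - sum config_weight ?M"
    by (simp add: config_weight_move sum_negf)
  finally have "sum config_weight ?M + sum config_weight ?N = 0"
    by simp
  moreover have "configs S = ?M \<union> ?N" "?M \<inter> ?N = {}"
    by auto
  ultimately show ?thesis
    using assms(1) by (metis (lifting) sum.union_disjoint finite_Un finite_configs)
qed

lemma sum_config_weight:
  assumes "finite S"
  shows "sum config_weight (configs S) =
    (\<Sum>i\<le>card S. of_nat (card S choose i) * (avoider_sum i * tiling_sum (card S - i)))"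
proof -
  have "sum config_weight (configs S) =
      (\<Sum>T\<in>Pow S. sum config_weight (avoiders T \<times> tilings (S - T)))"
    unfolding configs_eq_UN
  proof (rule sum.UNION_disjoint)
    show "\<forall>T\<in>Pow S. finite (avoiders T \<times> tilings (S - T))"
      using assms by (auto intro!: finite_cartesian_product dest: finite_subset)
    show "\<forall>T\<in>Pow S. \<forall>T'\<in>Pow S. T \<noteq> T' \<longrightarrow>
        (avoiders T \<times> tilings (S - T)) \<inter> (avoiders T' \<times> tilings (S - T')) = {}"
      by (auto simp: avoiders_def permutations_of_set_def)
  qed (use assms in simp)
  also have "\<dots> = (\<Sum>T\<in>Pow S. avoider_sum (card T) * tiling_sum (card S - card T))"
  proof (rule sum.cong)
    fix T assume "T \<in> Pow S"
    then have T_subset: "T \<subseteq> S" "finite T"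
      using assms by (auto dest: finite_subset)
    have "sum config_weight (avoiders T \<times> tilings (S - T)) =
        sum avoider_weight (avoiders T) * sum tiling_weight (tilings (S - T))"
      by (simp add: sum_product sum.cartesian_product config_weight_def)
    then show "sum config_weight (avoiders T \<times> tilings (S - T)) =
        avoider_sum (card T) * tiling_sum (card S - card T)"
      using T_subset assms by (simp add: sum_avoider_weight sum_tiling_weight card_Diff_subset)
  qed simp
  also have "\<dots> = (\<Sum>i\<le>card S. of_nat (card S choose i) * (avoider_sum i * tiling_sum (card S - i)))"
    by (rule sum_Pow_card[OF assms])
  finally show ?thesis .
qed

lemma NM_egf_times_tiling_egf: "NM_egf \<Gamma> * egf tiling_sum = 1"
proof (rule fps_ext)
  fix n
  show "fps_nth (NM_egf \<Gamma> * egf tiling_sum) n = fps_nth 1 n"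
    using sum_config_weight[of "{1..n}"] sum_config_weight_eq_0[of "{1..n}"]
    unfolding NM_egf_eq egf_mult
    by (cases "n = 0") (simp_all add: egf_def avoider_sum_0 tiling_sum_0)
qed

theorem U_eq_tiling_sum: "U \<Gamma> (int n) = tiling_sum n"
proof -
  let ?U = "egf (\<lambda>n. U \<Gamma> (int n))"
  have "NM_egf \<Gamma> * ?U = 1"
    unfolding egf_def by (rule NM_egf_times_U_egf)
  have "?U = (NM_egf \<Gamma> * ?U) * egf tiling_sum"
    using NM_egf_times_tiling_egf by (simp only: mult.assoc mult.left_commute) simp
  also have "\<dots> = egf tiling_sum"
    using \<open>NM_egf \<Gamma> * ?U = 1\<close> by simp
  finally have "?U = egf tiling_sum" .
  then show ?thesis
    using inj_egf[THEN injD] by metis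
qed

end

section \<open>Splitting off the first brick\<close>

context pattern_set
begin

definition hd_tilings :: "nat set \<Rightarrow> nat set \<Rightarrow> nat list list set" where
  "hd_tilings L S = {Bs \<in> tilings S. Bs \<noteq> [] \<and> length (hd Bs) \<in> L}"

definition hd_tiling_sum :: "nat set \<Rightarrow> nat \<Rightarrow> rat poly" where
  "hd_tiling_sum L n = sum tiling_weight (hd_tilings L {1..n})"

lemma finite_hd_tilings [simp]: "finite S \<Longrightarrow> finite (hd_tilings L S)"
  by (simp add: hd_tilings_def)

lemma sum_tiling_weight_hd_tilings:
  assumes "finite S"
  shows "sum tiling_weight (hd_tilings L S) = hd_tiling_sum L (card S)"
  unfolding hd_tiling_sum_def
proof (rule sum_eq_of_relabelling)
  fix T and h :: "nat \<Rightarrow> nat"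
  assume mono: "strict_mono_on T h"
  show "bij_betw (map (map h)) (hd_tilings L T) (hd_tilings L (h ` T))"
    unfolding hd_tilings_def
    by (rule bij_betw_Collect[OF bij_betw_map_tilings[OF mono]]) (auto simp: hd_map)
qed (use assms in \<open>auto simp: tiling_weight_def\<close>)

lemma tiling_sum_eq_hd_tiling_sum:
  assumes "1 \<le> n"
  shows "tiling_sum n = hd_tiling_sum UNIV n"
proof -
  have "hd_tilings UNIV {1..n} = tilings {1..n}"
    using assms by (auto simp: hd_tilings_def)
  then show ?thesis
    by (simp add: tiling_sum_def hd_tiling_sum_def)
qed

lemma hd_tiling_sum_Un:
  assumes "K \<inter> L = {}"
  shows "hd_tiling_sum (K \<union> L) n = hd_tiling_sum K n + hd_tiling_sum L n"
proof -
  have "hd_tilings (K \<union> L) {1..n} = hd_tilings K {1..n} \<union> hd_tilings L {1..n}"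
    by (auto simp: hd_tilings_def)
  moreover have "hd_tilings K {1..n} \<inter> hd_tilings L {1..n} = {}"
    using assms by (auto simp: hd_tilings_def)
  ultimately show ?thesis
    unfolding hd_tiling_sum_def by (simp add: sum.union_disjoint)
qed

definition continuations :: "nat set \<Rightarrow> nat set \<Rightarrow> nat list list set" where
  "continuations T S = {Cs \<in> tilings S. admissible (sorted_list_of_set T # Cs)}"

lemma Cons_in_hd_tilings_iff:
  assumes "finite S"
  shows "B # Cs \<in> hd_tilings L S \<longleftrightarrow>
    (\<exists>T\<subseteq>S. card T \<in> L \<and> B = sorted_list_of_set T \<and> Cs \<in> continuations T (S - T))"
proof
  assume tiling: "B # Cs \<in> hd_tilings L S"
  then have B_props: "incr B" "set B \<subseteq> S" "length B \<in> L" and Cs_tiling: "Cs \<in> tilings (S - set B)"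
    by (auto simp: hd_tilings_def tilings_def admissible_Cons brick_def)
  have "B = sorted_list_of_set (set B)"
    using B_props(1) by (intro strict_sorted_equal) auto
  moreover have "card (set B) \<in> L"
    using B_props distinct_card[of B] by (simp add: strict_sorted_iff)
  ultimately show "\<exists>T\<subseteq>S. card T \<in> L \<and> B = sorted_list_of_set T \<and> Cs \<in> continuations T (S - T)"
    using B_props Cs_tiling tiling
    by (intro exI[of _ "set B"]) (simp add: continuations_def hd_tilings_def tilings_def)
next
  assume "\<exists>T\<subseteq>S. card T \<in> L \<and> B = sorted_list_of_set T \<and> Cs \<in> continuations T (S - T)"
  then obtain T where T_props: "T \<subseteq> S" "card T \<in> L" "B = sorted_list_of_set T"
    "Cs \<in> continuations T (S - T)"
    by blast
  moreover have "finite T"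
    using T_props(1) assms by (rule finite_subset)
  ultimately show "B # Cs \<in> hd_tilings L S"
    by (auto simp: hd_tilings_def tilings_def continuations_def)
qed

lemma sum_hd_tilings:
  assumes "finite S"
  shows "sum tiling_weight (hd_tilings L S) =
    - yvar * (\<Sum>T | T \<subseteq> S \<and> card T \<in> L. sum tiling_weight (continuations T (S - T)))"
proof -
  let ?T = "{T. T \<subseteq> S \<and> card T \<in> L}"
  have finite: "finite T" if "T \<subseteq> S" for T
    using that assms by (rule finite_subset)
  have "sum tiling_weight (hd_tilings L S) =
      (\<Sum>(T, Cs)\<in>Sigma ?T (\<lambda>T. continuations T (S - T)). - yvar * tiling_weight Cs)"
  proof (rule sum.reindex_bij_witness[where i = "\<lambda>(T, Cs). sorted_list_of_set T # Cs"
        and j = "\<lambda>Bs. (set (hd Bs), tl Bs)"])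
    fix Bs assume Bs_in: "Bs \<in> hd_tilings L S"
    then obtain B Cs where "Bs = B # Cs"
      by (auto simp: hd_tilings_def neq_Nil_conv)
    then obtain T where "T \<subseteq> S" "card T \<in> L" "Cs \<in> continuations T (S - T)"
        "Bs = sorted_list_of_set T # Cs"
      using Bs_in Cons_in_hd_tilings_iff[OF assms] by auto
    then show "(case (set (hd Bs), tl Bs) of (T, Cs) \<Rightarrow> sorted_list_of_set T # Cs) = Bs"
      "(set (hd Bs), tl Bs) \<in> Sigma ?T (\<lambda>T. continuations T (S - T))"
      "(case (set (hd Bs), tl Bs) of (T, Cs) \<Rightarrow> - yvar * tiling_weight Cs) = tiling_weight Bs"
      using finite by (simp_all add: tiling_weight_def)
  qed (use Cons_in_hd_tilings_iff[OF assms] finite in auto)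
  also have "\<dots> = (\<Sum>T\<in>?T. \<Sum>Cs\<in>continuations T (S - T). - yvar * tiling_weight Cs)"
    using assms by (intro sum.Sigma[symmetric]) (auto simp: continuations_def)
  finally show ?thesis
    by (simp only: sum_distrib_left)
qed

end

section \<open>The patterns in \<open>\<Gamma>\<^bsub>k\<^sub>1,k\<^sub>2,s\<^esub>\<close>\<close>

definition two_run :: "nat \<Rightarrow> nat \<Rightarrow> nat list \<Rightarrow> bool" where
  "two_run k1 k2 w \<longleftrightarrow> length w = k1 + k2 \<and> incr (take k1 w) \<and> incr (drop k1 w) \<and>
     w ! 0 < w ! k1 \<and> w ! k1 < w ! 1"

lemma two_run_map_iff:
  assumes "strict_mono_on (set w) h" "2 \<le> k1" "1 \<le> k2"
  shows "two_run k1 k2 (map h w) \<longleftrightarrow> two_run k1 k2 w"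
proof (cases "length w = k1 + k2")
  case True
  have "w ! i \<in> set w" if "i \<le> k1" for i
    using that True assms(3) by (intro nth_mem) linarith
  then have "h (w ! i) < h (w ! j) \<longleftrightarrow> w ! i < w ! j" if "i \<le> k1" "j \<le> k1" for i j
    using that by (intro strict_mono_on_less[OF assms(1)])
  moreover have "incr (map h v) \<longleftrightarrow> incr v" if "set v \<subseteq> set w" for v
    using monotone_on_subset[OF assms(1) that] by (rule incr_map_iff)
  ultimately show ?thesis
    using True assms(2,3)
    by (simp add: two_run_def take_map drop_map set_take_subset set_drop_subset)
qed (simp add: two_run_def)

lemma run_heads_eq_1_2_iff:
  fixes a b c :: nat
  assumes incr: "incr (a # b # as)" "incr (c # cs)" and "b \<noteq> c"
    and set: "set (a # b # as) \<union> set (c # cs) = {1..n}"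
  shows "a = 1 \<and> c = 2 \<longleftrightarrow> a < c \<and> c < b"
proof
  assume "a = 1 \<and> c = 2"
  then show "a < c \<and> c < b"
    using incr(1) \<open>b \<noteq> c\<close> by simp
next
  assume c_between: "a < c \<and> c < b"
  then have c_le: "c \<le> x" if "x \<in> {1..n}" "x \<noteq> a" for x
    using that incr c_between unfolding set[symmetric] by auto
  have "a \<in> {1..n}" "c \<in> {1..n}"
    unfolding set[symmetric] by simp_all
  moreover from this have "a = 1"
    using c_le[of 1] c_between by auto
  ultimately show "a = 1 \<and> c = 2"
    using c_le[of 2] c_between by auto
qed

text \<open>Both runs increase, so \<open>\<sigma>\<^sub>1 = 1\<close> and \<open>\<sigma>\<^bsub>k\<^sub>1+1\<^esub> = 2\<close> only say how the smallest entry of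
  the second run compares with the first two entries.\<close>

lemma Gamma2_eq:
  assumes "2 \<le> k1" "1 \<le> k2"
  shows "Gamma2 k1 k2 = {\<sigma> \<in> permutations_of_set {1..k1 + k2}. two_run k1 k2 \<sigma>}"
proof -
  have "\<sigma> \<in> Gamma2 k1 k2 \<longleftrightarrow> two_run k1 k2 \<sigma>" if perm: "\<sigma> \<in> permutations_of_set {1..k1 + k2}" for \<sigma>
  proof (cases "incr (take k1 \<sigma>) \<and> incr (drop k1 \<sigma>)")
    case True
    have perm_\<sigma>: "distinct \<sigma>" "set \<sigma> = {1..k1 + k2}"
      using perm by (simp_all add: permutations_of_set_def)
    then have length_\<sigma>: "length \<sigma> = k1 + k2"
      using distinct_card[of \<sigma>] by simp
    then obtain n m where "length (take k1 \<sigma>) = Suc (Suc n)" "length (drop k1 \<sigma>) = Suc m"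
      using assms by (cases k1; cases "k1 - 1"; cases k2) auto
    then obtain a b as c cs where runs: "take k1 \<sigma> = a # b # as" "drop k1 \<sigma> = c # cs"
      unfolding length_Suc_conv by blast
    have set: "set (a # b # as) \<union> set (c # cs) = {1..k1 + k2}"
      using perm_\<sigma>(2) by (simp only: append_take_drop_id flip: runs set_append)
    have "\<sigma> ! 0 = a" "\<sigma> ! 1 = b" "\<sigma> ! k1 = c"
      using arg_cong[OF runs(1), of "\<lambda>xs. xs ! 0"] arg_cong[OF runs(1), of "\<lambda>xs. xs ! 1"]
        arg_cong[OF runs(2), of "\<lambda>xs. xs ! 0"] assms length_\<sigma> by simp_all
    moreover from this have "b \<noteq> c"
      using nth_eq_iff_index_eq[OF perm_\<sigma>(1), of 1 k1] assms length_\<sigma> by auto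
    ultimately show ?thesis
      using run_heads_eq_1_2_iff[OF _ _ _ set] True perm length_\<sigma> runs
      by (simp add: Gamma2_def two_run_def)
  qed (auto simp: Gamma2_def two_run_def)
  then show ?thesis
    by (auto simp: Gamma2_def)
qed

lemma red_in_Gamma2_iff:
  assumes "distinct w" "2 \<le> k1" "1 \<le> k2"
  shows "red w \<in> Gamma2 k1 k2 \<longleftrightarrow> two_run k1 k2 w"
  using red_in_permutations_of_set_iff[OF assms(1)]
    two_run_map_iff[OF strict_mono_on_rank[OF finite_set] assms(2,3), of w]
  by (auto simp: Gamma2_eq[OF assms(2,3)] red_eq_map_rank two_run_def)

lemma red_eq_upt_iff:
  assumes "distinct w"
  shows "red w = [1..<m + 1] \<longleftrightarrow> length w = m \<and> incr w"
proof -
  have "red w = [1..<m + 1] \<longleftrightarrow> incr (red w) \<and> set (red w) = {1..m}"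
    using strict_sorted_equal[of "red w" "[1..<m + 1]"]
    by (auto simp del: upt_Suc simp: atLeastLessThanSuc_atLeastAtMost)
  moreover have "set (red w) = {1..length w}"
    using rank_image[of "set w"] assms by (simp add: red_eq_map_rank distinct_card)
  moreover have "incr (red w) \<longleftrightarrow> incr w"
    by (simp add: red_eq_map_rank incr_map_iff strict_mono_on_rank)
  moreover have "{1..length w} = {1..m} \<longleftrightarrow> length w = m"
    by (metis card_atLeastAtMost diff_Suc_1)
  ultimately show ?thesis
    by metis
qed

lemma two_run_last_run:
  assumes "two_run k1 k2 w" "2 \<le> k1" "1 \<le> k2"
  shows "last_run (take k1 w) (drop k1 w)"
proof -
  have length_w: "length w = k1 + k2" and "w ! k1 < w ! 1"
    and incr: "incr (take k1 w)" "incr (drop k1 w)"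
    using assms(1) by (auto simp: two_run_def)
  moreover have "w ! 1 \<in> set (take k1 w)"
    using length_w assms(2) by (auto simp: in_set_conv_nth intro!: exI[of _ 1])
  then have "w ! 1 \<le> last (take k1 w)"
    by (rule incr_le_last[OF incr(1)])
  moreover have "hd (drop k1 w) = w ! k1"
    using length_w assms(3) by (simp add: hd_drop_conv_nth)
  ultimately show ?thesis
    using assms(3) by (auto simp: last_run_def)
qed

locale two_run_patterns =
  fixes k1 k2 s :: nat
  assumes k1_ge_2: "2 \<le> k1" and k2_ge_1: "1 \<le> k2" and k1_le_s: "k1 \<le> s"

sublocale two_run_patterns \<subseteq> single_descent_patterns "Gamma3 k1 k2 s"
proof
  fix \<gamma> assume \<gamma>: "\<gamma> \<in> Gamma3 k1 k2 s"
  show "des \<gamma> \<le> 1"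
  proof (cases "\<gamma> \<in> Gamma2 k1 k2")
    case True
    then have "incr (take k1 \<gamma>)" "incr (drop k1 \<gamma>)"
      by (simp_all add: Gamma2_def)
    then show ?thesis
      using des_append[of "take k1 \<gamma>" "drop k1 \<gamma>"] by (simp add: des_incr)
  next
    case False
    then have "\<gamma> = [1..<s + 2]"
      using \<gamma> by (simp add: Gamma3_def)
    then show ?thesis
      by (simp add: des_incr del: upt_Suc)
  qed
qed

context two_run_patterns
begin

lemma matches_iff:
  assumes "distinct w"
  shows "matches w \<longleftrightarrow> length w = s + 1 \<and> incr w \<or> two_run k1 k2 w"
proof -
  have "red w \<in> Gamma3 k1 k2 s \<longleftrightarrow> length w = s + 1 \<and> incr w \<or> two_run k1 k2 w"
    using red_in_Gamma2_iff[OF assms k1_ge_2 k2_ge_1] red_eq_upt_iff[OF assms, of "s + 1"]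
    by (auto simp: Gamma3_def simp del: upt_Suc)
  moreover have "2 \<le> length w" if "length w = s + 1 \<or> two_run k1 k2 w"
    using that k1_ge_2 k1_le_s by (auto simp: two_run_def)
  ultimately show ?thesis
    unfolding matches_def by blast
qed

lemma two_run_not_incr: "two_run k1 k2 w \<Longrightarrow> \<not> incr w"
  using k1_ge_2 k2_ge_1 sorted_wrt_nth_less[of "(<)" w 1 k1] by (auto simp: two_run_def)

lemma avoids_incr_iff:
  assumes "incr xs"
  shows "avoids xs \<longleftrightarrow> length xs \<le> s"
proof
  assume "avoids xs"
  then have "\<not> matches (take (s + 1) xs)"
    unfolding avoids_def by blast
  moreover have "incr (take (s + 1) xs)"
    using assms by (rule sorted_wrt_take)
  ultimately show "length xs \<le> s"
    using matches_iff[of "take (s + 1) xs"] by (auto simp: strict_sorted_iff)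
next
  assume "length xs \<le> s"
  moreover have "incr w" if "sublist w xs" for w
    using assms that by (auto simp: sublist_def sorted_wrt_append)
  ultimately show "avoids xs"
    unfolding avoids_def using matches_iff two_run_not_incr sublist_length_le
    by (fastforce simp: strict_sorted_iff)
qed

lemma brick_iff: "brick B \<longleftrightarrow> B \<noteq> [] \<and> incr B \<and> length B \<le> s"
  using avoids_incr_iff by (auto simp: brick_def)

section \<open>Bricks that may follow each other\<close>

lemma two_run_across_bricks:
  assumes brick_B: "brick B" and brick_C: "brick C" and distinct: "distinct (B @ C)"
    and "linked B C" and descent: "\<not> last B < hd C"
  obtains t x where "suffix t B" "prefix x C" "two_run k1 k2 (t @ x)"
    "length t = k1" "length x = k2"
proof -
  have "avoids B" "avoids C" "\<not> avoids (B @ C)"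
    using assms by (auto simp: brick_def linked_def)
  then obtain w where match_w: "matches w" "sublist w (B @ C)" "\<not> sublist w B" "\<not> sublist w C"
    unfolding avoids_def by blast
  then obtain t x where w_eq: "w = t @ x" and suffix_t: "suffix t B" and prefix_x: "prefix x C"
    using sublist_append[of w B C] by blast
  have nonempty: "t \<noteq> []" "x \<noteq> []"
    using match_w(3,4) w_eq suffix_imp_sublist[OF suffix_t] prefix_imp_sublist[OF prefix_x] by auto
  obtain z v where B_eq: "B = z @ t" and C_eq: "C = x @ v"
    using suffix_t prefix_x by (auto elim!: suffixE prefixE)
  have "last t \<noteq> hd x"
    using distinct last_in_set[OF nonempty(1)] hd_in_set[OF nonempty(2)] by (auto simp: B_eq C_eq)
  then have last_run: "last_run t x"
    using brick_B brick_C nonempty descent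
    by (auto simp: B_eq C_eq last_run_def brick_def sorted_wrt_append)
  have "\<not> incr w"
    using last_run nonempty by (auto simp: w_eq last_run_def sorted_wrt_append dest: less_asym)
  then have two_run: "two_run k1 k2 w"
    using match_w(1) distinct by (subst (asm) matches_iff) (auto simp: w_eq B_eq C_eq)
  then have "take k1 w = t \<and> drop k1 w = x"
    using last_run_unique[OF _ two_run_last_run last_run] k1_ge_2 k2_ge_1 w_eq
    by (metis append_take_drop_id)
  moreover have "length (take k1 w) = k1" "length (drop k1 w) = k2"
    using two_run by (simp_all add: two_run_def)
  ultimately show thesis
    using that suffix_t prefix_x two_run unfolding w_eq by simp
qed

lemma linked_descent_decomp:
  assumes "brick B" "brick C" "distinct (B @ C)" "linked B C" "\<not> last B < hd C"
  obtains xs ys where "B = xs @ ys" "xs \<noteq> []" "length ys = k1 - 1" "k2 \<le> length C"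
    "last xs < hd C" "hd C < hd ys"
proof -
  obtain t x where "suffix t B" "prefix x C" and two_run: "two_run k1 k2 (t @ x)"
    and length: "length t = k1" "length x = k2"
    using two_run_across_bricks[OF assms] .
  then obtain z v where B_eq: "B = z @ t" and C_eq: "C = x @ v"
    by (auto elim!: suffixE prefixE)
  obtain a b ts where t_eq: "t = a # b # ts"
    using length(1) k1_ge_2 by (cases t; cases "tl t") auto
  have "x \<noteq> []"
    using length(2) k2_ge_1 by auto
  then have "(t @ x) ! 0 = a" "(t @ x) ! 1 = b" "(t @ x) ! k1 = hd C"
    using length(1) by (auto simp: t_eq C_eq nth_append hd_conv_nth)
  then have "a < hd C" "hd C < b"
    using two_run by (simp_all add: two_run_def)
  then show thesis
    using that[of "z @ [a]" "b # ts"] length by (simp add: B_eq t_eq C_eq)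
qed

lemma linked_if_descent_decomp:
  assumes brick_C: "brick C" and incr_B: "incr (xs @ ys)" and "xs \<noteq> []" "length ys = k1 - 1"
    and "k2 \<le> length C" "last xs < hd C" "hd C < hd ys" and distinct: "distinct (xs @ ys @ C)"
  shows "linked (xs @ ys) C"
proof -
  let ?w = "(last xs # ys) @ take k2 C"
  obtain y ys' where ys_eq: "ys = y # ys'"
    using assms(4) k1_ge_2 by (cases ys) auto
  have xs_eq: "xs = butlast xs @ [last xs]"
    using \<open>xs \<noteq> []\<close> by simp
  have "incr (butlast xs @ last xs # ys)"
    using incr_B by (subst (asm) xs_eq) simp
  then have "incr (last xs # ys)"
    by (simp add: sorted_wrt_append)
  moreover have length_run: "length (last xs # ys) = k1"
    using assms(4) k1_ge_2 by simp
  moreover have "incr (take k2 C)" "hd C = take k2 C ! 0"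
    using brick_C k2_ge_1 by (simp_all add: brick_def sorted_wrt_take hd_conv_nth)
  moreover have "take k1 ?w = last xs # ys" "drop k1 ?w = take k2 C" "?w ! k1 = take k2 C ! 0"
    unfolding take_append drop_append nth_append length_run by (simp_all flip: length_run)
  ultimately have "two_run k1 k2 ?w"
    using assms(5-7) by (simp add: two_run_def ys_eq)
  moreover have append_eq: "(xs @ ys) @ C = butlast xs @ ?w @ drop k2 C"
    by (subst xs_eq) simp
  moreover from this have "distinct (butlast xs @ ?w @ drop k2 C)"
    using distinct by (simp only: append_assoc)
  then have "distinct ?w"
    unfolding distinct_append by blast
  ultimately have "matches ?w"
    by (simp add: matches_iff)
  then show ?thesis
    unfolding linked_def avoids_def sublist_def using append_eq by metis
qed

definition may_precede :: "nat set \<Rightarrow> nat list \<Rightarrow> bool" where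
  "may_precede T C \<longleftrightarrow> (\<exists>x\<in>T. x < hd C) \<and>
     (card {x \<in> T. hd C < x} = 0 \<or> card {x \<in> T. hd C < x} = k1 - 1 \<and> k2 \<le> length C)"

lemma linked_imp_may_precede:
  assumes brick_B: "brick B" and brick_C: "brick C" and distinct: "distinct (B @ C)"
    and linked: "linked B C"
  shows "may_precede (set B) C"
proof (cases "last B < hd C")
  case True
  then have "x < hd C" if "x \<in> set B" for x
    using brick_B incr_le_last[OF _ that] by (auto simp: brick_def)
  moreover from this have "{x \<in> set B. hd C < x} = {}"
    by fastforce
  moreover have "hd B \<in> set B"
    using brick_B by (simp add: brick_def)
  ultimately show ?thesis
    unfolding may_precede_def by (metis card.empty)
next
  case False
  then obtain xs ys where B_eq: "B = xs @ ys" and last_xs: "xs \<noteq> []" "last xs < hd C"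
    and hd_ys: "length ys = k1 - 1" "hd C < hd ys" and "k2 \<le> length C"
    using linked_descent_decomp[OF brick_B brick_C distinct linked] by blast
  have incr: "incr xs" "incr ys"
    using brick_B by (auto simp: B_eq brick_def sorted_wrt_append)
  have "x < hd C" if "x \<in> set xs" for x
    using incr_le_last[OF incr(1) that] last_xs(2) by simp
  moreover have "hd C < y" if "y \<in> set ys" for y
    using incr_hd_le[OF incr(2) that] hd_ys(2) by simp
  ultimately have "{x \<in> set B. hd C < x} = set ys"
    by (fastforce simp: B_eq)
  then have "card {x \<in> set B. hd C < x} = k1 - 1"
    using hd_ys(1) distinct distinct_card[of ys] by (simp add: B_eq)
  moreover have "last xs \<in> set B"
    using last_xs(1) by (simp add: B_eq)
  ultimately show ?thesis
    using last_xs(2) \<open>k2 \<le> length C\<close> unfolding may_precede_def by blast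
qed

lemma may_precede_imp_linked:
  assumes brick_B: "brick B" and brick_C: "brick C" and distinct: "distinct (B @ C)"
    and precede: "may_precede (set B) C"
  shows "linked B C"
proof -
  define xs ys where "xs = filter (\<lambda>x. x < hd C) B" and "ys = filter (\<lambda>x. hd C < x) B"
  have "hd C \<notin> set B"
    using brick_C distinct by (auto simp: brick_def)
  then have B_eq: "B = xs @ ys"
    using brick_B incr_eq_filter_append_filter by (auto simp: xs_def ys_def brick_def)
  have card_greater: "card {x \<in> set B. hd C < x} = length ys"
    using distinct distinct_card[of ys] by (simp add: ys_def)
  have "xs \<noteq> []"
    using precede by (auto simp: may_precede_def xs_def filter_empty_conv)
  then have "last xs < hd C"
    using last_in_set[of xs] by (simp add: xs_def)
  show ?thesis
  proof (cases "ys = []")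
    case True
    then show ?thesis
      using \<open>last xs < hd C\<close> by (simp add: B_eq linked_def)
  next
    case False
    then have "hd C < hd ys"
      using hd_in_set[of ys] by (auto simp: ys_def)
    moreover have "length ys = k1 - 1" "k2 \<le> length C"
      using precede False unfolding may_precede_def card_greater by auto
    ultimately show ?thesis
      using linked_if_descent_decomp[OF brick_C, of xs ys] brick_B distinct
        \<open>xs \<noteq> []\<close> \<open>last xs < hd C\<close>
      by (simp add: B_eq brick_def)
  qed
qed

lemma linked_imp_hd_less:
  assumes "brick B" "brick C" "distinct (B @ C)" "linked B C"
  shows "hd B < hd C"
proof -
  obtain x where "x \<in> set B" "x < hd C"
    using linked_imp_may_precede[OF assms] by (auto simp: may_precede_def)
  moreover from this have "hd B \<le> x"
    using assms(1) by (intro incr_hd_le) (simp_all add: brick_def)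
  ultimately show ?thesis
    by simp
qed

lemma admissible_hd_le:
  "admissible Bs \<Longrightarrow> distinct (concat Bs) \<Longrightarrow> x \<in> set (concat Bs) \<Longrightarrow> hd (hd Bs) \<le> x"
proof (induction Bs)
  case (Cons B Bs)
  then have brick_props: "brick B" "admissible Bs" "distinct (concat Bs)"
    by (auto simp: admissible_Cons)
  show ?case
  proof (cases "x \<in> set B")
    case True
    then show ?thesis
      using brick_props(1) by (simp add: brick_def incr_hd_le)
  next
    case False
    then have x_later: "x \<in> set (concat Bs)" and "Bs \<noteq> []"
      using Cons.prems by auto
    then have "brick (hd Bs)" "linked B (hd Bs)" "distinct (B @ hd Bs)"
      using Cons.prems by (auto simp: admissible_def neq_Nil_conv)
    then have "hd B < hd (hd Bs)"
      using linked_imp_hd_less brick_props(1) by blast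
    also have "\<dots> \<le> x"
      using Cons.IH[OF brick_props(2,3) x_later] .
    finally show ?thesis
      by simp
  qed
qed simp

lemma hd_hd_tiling:
  assumes "Bs \<in> tilings S" "m \<in> S" "\<And>x. x \<in> S \<Longrightarrow> m \<le> x"
  shows "hd (hd Bs) = m"
proof (rule antisym)
  have Bs_props: "admissible Bs" "distinct (concat Bs)" "set (concat Bs) = S"
    using assms(1) by (auto simp: tilings_def)
  show "hd (hd Bs) \<le> m"
    using admissible_hd_le[OF Bs_props(1,2)] assms(2) Bs_props(3) by blast
  have "Bs \<noteq> []"
    using Bs_props(3) assms(2) by auto
  then have "hd (hd Bs) \<in> set (concat Bs)"
    using Bs_props(1) by (auto simp: admissible_def brick_def neq_Nil_conv)
  then show "m \<le> hd (hd Bs)"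
    using assms(3) Bs_props(3) by blast
qed

section \<open>The recursion\<close>

lemma continuations_eq:
  assumes "finite T" "T \<inter> S = {}" "S \<noteq> {}"
  shows "continuations T S = {Cs \<in> tilings S. card T \<le> s \<and> may_precede T (hd Cs)}"
proof -
  let ?B = "sorted_list_of_set T"
  have "admissible (?B # Cs) \<longleftrightarrow> card T \<le> s \<and> may_precede T (hd Cs)"
    if Cs_tiling: "Cs \<in> tilings S" for Cs
  proof (cases "brick ?B")
    case True
    have "Cs \<noteq> []" "admissible Cs"
      using Cs_tiling assms(3) by (auto simp: tilings_def)
    then have "brick (hd Cs)" "set (hd Cs) \<subseteq> S" "distinct (hd Cs)"
      using Cs_tiling by (auto simp: admissible_def tilings_def neq_Nil_conv)
    moreover from this have "distinct (?B @ hd Cs)"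
      using assms(1,2) by auto
    ultimately have "linked ?B (hd Cs) \<longleftrightarrow> may_precede T (hd Cs)"
      using linked_imp_may_precede[OF True] may_precede_imp_linked[OF True] assms(1) by fastforce
    then show ?thesis
      using True \<open>Cs \<noteq> []\<close> \<open>admissible Cs\<close> by (simp add: admissible_Cons brick_iff)
  next
    case False
    then show ?thesis
      using assms(1) by (auto simp: admissible_Cons brick_iff may_precede_def)
  qed
  then show ?thesis
    by (auto simp: continuations_def)
qed

lemma continuations_without_1:
  assumes "T \<subseteq> {1..n}" "1 \<notin> T"
  shows "continuations T ({1..n} - T) = {}"
proof (cases "T = {}")
  case True
  then show ?thesis
    by (simp add: continuations_def admissible_Cons brick_def)
next
  case False
  then have one_mem: "1 \<in> {1..n} - T"
    using assms by auto
  have "\<not> may_precede T (hd Cs)" if "Cs \<in> tilings ({1..n} - T)" for Cs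
  proof -
    have "hd (hd Cs) = 1"
      using that one_mem by (rule hd_hd_tiling) simp
    then show ?thesis
      using assms(1) by (fastforce simp: may_precede_def)
  qed
  then show ?thesis
    using one_mem finite_subset[OF assms(1)] by (subst continuations_eq) auto
qed

text \<open>The total weight of the tilings that may follow a first brick with entries \<open>1, \<dots>, r\<close> and
  \<open>j\<close> further entries above \<open>r + 1\<close>, in a tiling of \<open>{1..n}\<close>.\<close>

definition continuation_sum :: "nat \<Rightarrow> nat \<Rightarrow> nat \<Rightarrow> rat poly" where
  "continuation_sum n r j =
     (if s < r + j then 0
      else if j = 0 then tiling_sum (n - r)
      else if j = k1 - 1 then hd_tiling_sum {k2..} (n - (r + j))
      else 0)"

lemma continuations_initial_segment_Un:
  assumes r_bounds: "1 \<le> r" "r \<le> n" and Y_subset: "Y \<subseteq> {r + 2..n}" and T_eq: "T = {1..r} \<union> Y"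
  shows "continuations T ({1..n} - T) =
    (if s < card T then {} else if Y = {} then tilings ({1..n} - T)
     else if card Y = k1 - 1 then hd_tilings {k2..} ({1..n} - T) else {})"
proof (cases "r = n")
  case True
  then have "Y = {}"
    using Y_subset by simp
  then show ?thesis
    using True r_bounds(1) by (auto simp: T_eq continuations_def admissible_Cons brick_iff)
next
  case False
  define S where "S = {1..n} - T"
  have "finite Y"
    using Y_subset by (rule finite_subset) simp
  then have "finite T" "T \<inter> S = {}"
    by (auto simp: S_def T_eq)
  have S_least: "r + 1 \<in> S" "\<And>x. x \<in> S \<Longrightarrow> r + 1 \<le> x"
    using False r_bounds Y_subset by (auto simp: S_def T_eq)
  have "may_precede T (hd Cs) \<longleftrightarrow> Y = {} \<or> card Y = k1 - 1 \<and> k2 \<le> length (hd Cs)"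
    if "Cs \<in> tilings S" for Cs
  proof -
    have "hd (hd Cs) = r + 1"
      using that S_least by (rule hd_hd_tiling)
    moreover have "{x \<in> T. r + 1 < x} = Y" "\<exists>x\<in>T. x < r + 1"
      using Y_subset r_bounds(1) by (auto simp: T_eq)
    ultimately show ?thesis
      using \<open>finite Y\<close> by (simp add: may_precede_def)
  qed
  moreover have "Cs \<noteq> []" if "Cs \<in> tilings S" for Cs
    using that S_least(1) by (metis Nil_in_tilings_iff empty_iff)
  moreover have "S \<noteq> {}"
    using S_least(1) by auto
  ultimately show ?thesis
    using continuations_eq[OF \<open>finite T\<close> \<open>T \<inter> S = {}\<close>] unfolding S_def[symmetric]
    by (auto simp: hd_tilings_def)
qed

lemma sum_continuations:
  assumes r_bounds: "1 \<le> r" "r \<le> n" and Y_subset: "Y \<subseteq> {r + 2..n}" and T_eq: "T = {1..r} \<union> Y"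
  shows "sum tiling_weight (continuations T ({1..n} - T)) = continuation_sum n r (card Y)"
proof -
  have "finite Y"
    using Y_subset by (rule finite_subset) simp
  have "card T = r + card Y"
    unfolding T_eq using \<open>finite Y\<close> Y_subset by (subst card_Un_disjoint) auto
  moreover from this have "card ({1..n} - T) = n - (r + card Y)"
    unfolding T_eq using r_bounds Y_subset \<open>finite Y\<close> by (subst card_Diff_subset) auto
  ultimately show ?thesis
    using \<open>finite Y\<close> unfolding continuations_initial_segment_Un[OF assms]
    by (simp add: sum_tiling_weight sum_tiling_weight_hd_tilings continuation_sum_def)
qed

lemma sum_Pow_continuation_sum:
  assumes "finite A"
  shows "(\<Sum>Y\<in>Pow A. if r + card Y \<in> L then continuation_sum n r (card Y) else 0) =
    (if r \<in> L then continuation_sum n r 0 else 0) +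
    of_nat (card A choose (k1 - 1)) *
      (if r + (k1 - 1) \<in> L then continuation_sum n r (k1 - 1) else 0)"
proof -
  let ?f = "\<lambda>j. if r + j \<in> L then continuation_sum n r j else 0"
  have "(\<Sum>Y\<in>Pow A. ?f (card Y)) = (\<Sum>j\<le>card A. of_nat (card A choose j) * ?f j)"
    using assms by (rule sum_Pow_card)
  also have "\<dots> = (\<Sum>j\<in>{0, k1 - 1}. of_nat (card A choose j) * ?f j)"
    by (rule sum.mono_neutral_cong) (auto simp: continuation_sum_def)
  finally show ?thesis
    using k1_ge_2 by simp
qed

lemma hd_tiling_sum_eq_sum_continuation_sum:
  "hd_tiling_sum L n = - yvar * (\<Sum>r = 1..n.
    (if r \<in> L then continuation_sum n r 0 else 0) +
    of_nat ((n - (r + 1)) choose (k1 - 1)) *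
      (if r + (k1 - 1) \<in> L then continuation_sum n r (k1 - 1) else 0))"
proof -
  let ?f = "\<lambda>T. sum tiling_weight (continuations T ({1..n} - T))"
  have "(\<Sum>T | T \<subseteq> {1..n} \<and> card T \<in> L. ?f T) =
      (\<Sum>T | T \<subseteq> {1..n} \<and> 1 \<in> T. if card T \<in> L then ?f T else 0)"
    by (rule sum.mono_neutral_cong) (auto simp: continuations_without_1[unfolded One_nat_def])
  also have "\<dots> = (\<Sum>r = 1..n. \<Sum>Y\<in>Pow {r + 2..n}.
      if r + card Y \<in> L then continuation_sum n r (card Y) else 0)"
    unfolding sum_subsets_containing_1
  proof (intro sum.cong refl)
    fix r Y assume r_range: "r \<in> {1..n}" and "Y \<in> Pow {r + 2..n}"
    then have Y_props: "Y \<subseteq> {r + 2..n}" "finite Y"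
      using finite_subset by auto
    then have "card ({1..r} \<union> Y) = r + card Y"
      by (subst card_Un_disjoint) auto
    then show "(if card ({1..r} \<union> Y) \<in> L then ?f ({1..r} \<union> Y) else 0) =
        (if r + card Y \<in> L then continuation_sum n r (card Y) else 0)"
      using r_range sum_continuations[of r n Y] Y_props(1) by simp
  qed
  finally show ?thesis
    unfolding hd_tiling_sum_def[of L] sum_hd_tilings[OF finite_atLeastAtMost]
    by (simp add: sum_Pow_continuation_sum)
qed

abbreviation u :: "int \<Rightarrow> rat poly" where
  "u \<equiv> U (Gamma3 k1 k2 s)"

lemma continuation_sum_0:
  "r \<le> n \<Longrightarrow> continuation_sum n r 0 = (if r \<le> s then u (int n - int r) else 0)"
  using U_eq_tiling_sum[of "n - r"] by (simp add: continuation_sum_def of_nat_diff)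

lemma continuation_sum_k1:
  "1 \<le> r \<Longrightarrow> continuation_sum n r (k1 - 1) =
    (if r - 1 \<le> s - k1 then hd_tiling_sum {k2..} (n - (r - 1 + k1)) else 0)"
  using k1_ge_2 k1_le_s by (auto simp: continuation_sum_def)

lemma hd_tiling_sum_eq:
  "hd_tiling_sum L n = - yvar * (\<Sum>r\<in>{1..s} \<inter> L. u (int n - int r)) -
    yvar * (\<Sum>p\<in>{0..s - k1} \<inter> {p. p + k1 \<in> L}.
      of_nat ((n - (p + 2)) choose (k1 - 1)) * hd_tiling_sum {k2..} (n - (p + k1)))"
proof -
  let ?c = "\<lambda>r. of_nat ((n - (r + 1)) choose (k1 - 1)) * continuation_sum n r (k1 - 1)"
  have "(\<Sum>r = 1..n. if r \<in> L then continuation_sum n r 0 else 0) =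
      (\<Sum>r\<in>{1..s} \<inter> L. u (int n - int r))"
  proof (rule sum.mono_neutral_cong)
    fix r assume "r \<in> {1..s} \<inter> L - {1..n}"
    then show "u (int n - int r) = 0"
      by (auto simp: U_def)
  qed (auto simp: continuation_sum_0)
  moreover have "(\<Sum>r = 1..n. of_nat ((n - (r + 1)) choose (k1 - 1)) *
      (if r + (k1 - 1) \<in> L then continuation_sum n r (k1 - 1) else 0)) =
    (\<Sum>r\<in>{1..s - k1 + 1} \<inter> {r. r + (k1 - 1) \<in> L}. ?c r)"
    using k1_ge_2
    by (intro sum.mono_neutral_cong) (auto simp: continuation_sum_k1[unfolded One_nat_def])
  moreover have "\<dots> = (\<Sum>p\<in>{0..s - k1} \<inter> {p. p + k1 \<in> L}.
      of_nat ((n - (p + 2)) choose (k1 - 1)) * hd_tiling_sum {k2..} (n - (p + k1)))"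
    using k1_ge_2 by (intro sum.reindex_bij_witness[where i = "\<lambda>p. p + 1" and j = "\<lambda>r. r - 1"])
      (auto simp: continuation_sum_k1[unfolded One_nat_def])
  ultimately show ?thesis
    by (subst hd_tiling_sum_eq_sum_continuation_sum) (simp add: sum.distrib algebra_simps)
qed

lemma hd_tiling_sum_ge_k2:
  assumes "k2 \<le> k1" "1 \<le> n"
  shows "hd_tiling_sum {k2..} n = u (int n) + yvar * (\<Sum>a = 1..k2 - 1. u (int n - int a))"
proof -
  have "{..<k2} \<union> {k2..} = UNIV" "{..<k2} \<inter> {k2..} = {}"
    by auto
  then have "u (int n) = hd_tiling_sum {..<k2} n + hd_tiling_sum {k2..} n"
    using hd_tiling_sum_Un[of "{..<k2}" "{k2..}" n] tiling_sum_eq_hd_tiling_sum[OF assms(2)]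
    by (simp add: U_eq_tiling_sum)
  moreover have "{1..s} \<inter> {..<k2} = {1..k2 - 1}" "{0..s - k1} \<inter> {p. p + k1 \<in> {..<k2}} = {}"
    using assms(1) k1_le_s by auto
  then have "hd_tiling_sum {..<k2} n = - yvar * (\<Sum>a = 1..k2 - 1. u (int n - int a))"
    by (simp add: hd_tiling_sum_eq[of "{..<k2}"])
  ultimately show ?thesis
    by simp
qed

lemma binomial_times_hd_tiling_sum:
  assumes "k2 \<le> k1"
  shows "of_nat ((n - (p + 2)) choose (k1 - 1)) * hd_tiling_sum {k2..} (n - (p + k1)) =
    of_nat (nat (int n - int p - 2) choose (k1 - 1)) * (u (int n - int p - int k1) +
      yvar * (\<Sum>a = 1..k2 - 1. u (int n - int p - int k1 - int a)))"
proof -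
  have nat_eq: "nat (int n - int p - 2) = n - (p + 2)"
    by linarith
  show ?thesis
  proof (cases "1 \<le> n - (p + k1)")
    case True
    then have "int (n - (p + k1)) = int n - int p - int k1"
      by linarith
    then show ?thesis
      using hd_tiling_sum_ge_k2[OF assms True] nat_eq by simp
  next
    case False
    then have "(n - (p + 2)) choose (k1 - 1) = 0"
      using k1_ge_2 by (intro binomial_eq_0) linarith
    then show ?thesis
      unfolding nat_eq by simp
  qed
qed

theorem U_recursion:
  assumes "k2 \<le> k1" "1 \<le> n"
  shows "u (int n) = - yvar * (\<Sum>r = 1..k1 - 1. u (int n - int r)) -
    yvar * (\<Sum>p = 0..s - k1.
      (1 + of_nat (nat (int n - int p - 2) choose (k1 - 1))) * u (int n - int p - int k1) +
      yvar * of_nat (nat (int n - int p - 2) choose (k1 - 1)) *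
        (\<Sum>a = 1..k2 - 1. u (int n - int p - int k1 - int a)))"
proof -
  have "(\<Sum>r = 1..s. u (int n - int r)) =
      (\<Sum>r = 1..k1 - 1. u (int n - int r)) + (\<Sum>r = k1..s. u (int n - int r))"
    using k1_ge_2 k1_le_s
      sum.ub_add_nat[of 1 "k1 - 1" "\<lambda>r. u (int n - int r)" "s - (k1 - 1)"] by simp
  also have "(\<Sum>r = k1..s. u (int n - int r)) = (\<Sum>p = 0..s - k1. u (int n - int p - int k1))"
    using k1_le_s sum.shift_bounds_cl_nat_ivl[of "\<lambda>r. u (int n - int r)" 0 k1 "s - k1"]
    by (simp add: algebra_simps)
  finally have split_sum: "(\<Sum>r = 1..s. u (int n - int r)) =
      (\<Sum>r = 1..k1 - 1. u (int n - int r)) + (\<Sum>p = 0..s - k1. u (int n - int p - int k1))" .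
  have "u (int n) = hd_tiling_sum UNIV n"
    using assms(2) by (simp add: U_eq_tiling_sum tiling_sum_eq_hd_tiling_sum)
  also have "\<dots> = - yvar * (\<Sum>r = 1..s. u (int n - int r)) -
      yvar * (\<Sum>p = 0..s - k1. of_nat (nat (int n - int p - 2) choose (k1 - 1)) *
        (u (int n - int p - int k1) + yvar * (\<Sum>a = 1..k2 - 1. u (int n - int p - int k1 - int a))))"
    unfolding hd_tiling_sum_eq[of UNIV] binomial_times_hd_tiling_sum[OF assms(1)] by simp
  finally show ?thesis
    unfolding split_sum by (simp add: sum.distrib algebra_simps)
qed

end

theorem theorem4:
  fixes k1 s :: nat and \<Gamma> :: "nat list set"
  assumes "2 \<le> k1" and "k1 \<le> s"
    and "\<Gamma> = Gamma3 k1 k1 s"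
  shows "U \<Gamma> 1 = - yvar \<and>
    (\<forall>n::nat. n \<ge> 2 \<longrightarrow>
      U \<Gamma> (int n) =
        - yvar * (\<Sum>r = 1..k1 - 1. U \<Gamma> (int n - int r))
        - yvar * (\<Sum>p = 0..s - k1.
            (1 + of_nat (nat (int n - int p - 2) choose (k1 - 1))) * U \<Gamma> (int n - int p - int k1)
            + yvar * of_nat (nat (int n - int p - 2) choose (k1 - 1))
                * (\<Sum>a = 1..k1 - 1. U \<Gamma> (int n - int p - int k1 - int a))))"
proof -
  interpret two_run_patterns k1 k1 s
    using assms by unfold_locales auto
  have U_0: "U \<Gamma> 0 = 1"
    using U_eq_tiling_sum[of 0] assms(3) by (simp add: tiling_sum_0)
  have U_neg: "U \<Gamma> j = 0" if "j < 0" for j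
    using that by (simp add: U_def)
  have "(\<Sum>r = 1..k1 - 1. U \<Gamma> (1 - int r)) = U \<Gamma> 0"
    using assms(1) by (subst sum.atLeast_Suc_atMost) (auto simp: U_neg)
  then have "U \<Gamma> 1 = - yvar"
    using U_recursion[of 1] assms(1,3) U_0 U_neg by (simp add: binomial_eq_0)
  then show ?thesis
    using U_recursion assms(3) by simp
qed

end
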